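(* If $G$ is a boiler, then $\chi(G)\le\lceil\frac54\omega(G)\rceil$.
   Context: A boiler is a $(P_6,C_4,C_6)$-free graph whose vertex set is partitioned into five sets $Q,A,B,L,M$ such that: $Q,A,B,M$ are non-empty and $Q,A,B$ are cliques; $Q$ is complete to $A$ and to $M$, and $B$ is complete to $L$; $Q$ is anticomplete to $B$ and to $L$, and $L$ is anticomplete to $M$; $G[L]$ and $G[M]$ are $(P_4,2P_3)$-free; every vertex of $L$ has a neighbor in $A$; for some integer $k\ge 3$, $M$ is partitioned into $k$ non-empty pairwise anticomplete sets $M_1,\dots,M_k$ and $B$ into $k$ non-empty sets $B_1,\dots,B_k$ such that for each $i$ every vertex of $M_i$ has a neighbor in $B_i$ and no neighbor in $B\setminus B_i$, and every vertex of $B$ has a neighbor in $M$; $A$ is complete to $M_1\cup B_1\cup M_2\cup B_2$, for each $i\in\{3,\dots,k\}$ every vertex of $A$ is complete or anticomplete to $M_i\cup B_i$, and no vertex of $A$ is complete to $B$. Complete/anticomplete: all edges / no edges between the sets; $2P_3$ is the disjoint union of two copies of $P_3$. *)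

theory Defs
  imports Complex_Main
begin

text \<open>Finite simple graphs: a finite vertex set V and a symmetric irreflexive
adjacency relation E (only its restriction to V matters).\<close>

definition graph :: "'a set \<Rightarrow> ('a \<Rightarrow> 'a \<Rightarrow> bool) \<Rightarrow> bool" where
  "graph V E \<longleftrightarrow> finite V \<and> (\<forall>u v. E u v \<longrightarrow> E v u) \<and> (\<forall>v. \<not> E v v)"

definition path_pat :: "nat \<Rightarrow> nat \<Rightarrow> bool" where
  "path_pat i j \<longleftrightarrow> i + 1 = j \<or> j + 1 = i"

definition cycle_pat :: "nat \<Rightarrow> nat \<Rightarrow> nat \<Rightarrow> bool" where
  "cycle_pat n i j \<longleftrightarrow> (i + 1) mod n = j \<or> (j + 1) mod n = i"

definition twoP3_pat :: "nat \<Rightarrow> nat \<Rightarrow> bool" where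
  "twoP3_pat i j \<longleftrightarrow> {i, j} \<in> {{0,1},{1,2},{3,4},{4,5}}"

definition has_induced :: "'a set \<Rightarrow> ('a \<Rightarrow> 'a \<Rightarrow> bool) \<Rightarrow> nat \<Rightarrow> (nat \<Rightarrow> nat \<Rightarrow> bool) \<Rightarrow> bool" where
  "has_induced S E n H \<longleftrightarrow> (\<exists>f. inj_on f {0..<n} \<and> f ` {0..<n} \<subseteq> S \<and>
      (\<forall>i<n. \<forall>j<n. i \<noteq> j \<longrightarrow> (E (f i) (f j) \<longleftrightarrow> H i j)))"

abbreviation P_free :: "nat \<Rightarrow> 'a set \<Rightarrow> ('a \<Rightarrow> 'a \<Rightarrow> bool) \<Rightarrow> bool" where
  "P_free n S E \<equiv> \<not> has_induced S E n path_pat"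

abbreviation C_free :: "nat \<Rightarrow> 'a set \<Rightarrow> ('a \<Rightarrow> 'a \<Rightarrow> bool) \<Rightarrow> bool" where
  "C_free n S E \<equiv> \<not> has_induced S E n (cycle_pat n)"

abbreviation twoP3_free :: "'a set \<Rightarrow> ('a \<Rightarrow> 'a \<Rightarrow> bool) \<Rightarrow> bool" where
  "twoP3_free S E \<equiv> \<not> has_induced S E 6 twoP3_pat"

definition clique :: "('a \<Rightarrow> 'a \<Rightarrow> bool) \<Rightarrow> 'a set \<Rightarrow> bool" where
  "clique E K \<longleftrightarrow> (\<forall>u\<in>K. \<forall>v\<in>K. u \<noteq> v \<longrightarrow> E u v)"

definition complete_to :: "('a \<Rightarrow> 'a \<Rightarrow> bool) \<Rightarrow> 'a set \<Rightarrow> 'a set \<Rightarrow> bool" where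
  "complete_to E X Y \<longleftrightarrow> (\<forall>x\<in>X. \<forall>y\<in>Y. E x y)"

definition anticomplete_to :: "('a \<Rightarrow> 'a \<Rightarrow> bool) \<Rightarrow> 'a set \<Rightarrow> 'a set \<Rightarrow> bool" where
  "anticomplete_to E X Y \<longleftrightarrow> (\<forall>x\<in>X. \<forall>y\<in>Y. \<not> E x y)"

definition clique_number :: "'a set \<Rightarrow> ('a \<Rightarrow> 'a \<Rightarrow> bool) \<Rightarrow> nat" where
  "clique_number V E = Max {card K | K. K \<subseteq> V \<and> clique E K}"

definition chromatic_number :: "'a set \<Rightarrow> ('a \<Rightarrow> 'a \<Rightarrow> bool) \<Rightarrow> nat" where
  "chromatic_number V E = (LEAST k. \<exists>c :: 'a \<Rightarrow> nat. (\<forall>v\<in>V. c v < k) \<and>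
      (\<forall>u\<in>V. \<forall>v\<in>V. E u v \<longrightarrow> c u \<noteq> c v))"

definition boiler :: "'a set \<Rightarrow> ('a \<Rightarrow> 'a \<Rightarrow> bool) \<Rightarrow> bool" where
  "boiler V E \<longleftrightarrow> graph V E \<and> P_free 6 V E \<and> C_free 4 V E \<and> C_free 6 V E \<and>
   (\<exists>Q A B L M k Ms Bs.
      Q \<union> A \<union> B \<union> L \<union> M = V \<and>
      Q \<inter> A = {} \<and> Q \<inter> B = {} \<and> Q \<inter> L = {} \<and> Q \<inter> M = {} \<and>
      A \<inter> B = {} \<and> A \<inter> L = {} \<and> A \<inter> M = {} \<and>
      B \<inter> L = {} \<and> B \<inter> M = {} \<and> L \<inter> M = {} \<and>
      Q \<noteq> {} \<and> A \<noteq> {} \<and> B \<noteq> {} \<and> M \<noteq> {} \<and>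
      clique E Q \<and> clique E A \<and> clique E B \<and>
      complete_to E Q A \<and> complete_to E Q M \<and> complete_to E B L \<and>
      anticomplete_to E Q B \<and> anticomplete_to E Q L \<and> anticomplete_to E L M \<and>
      P_free 4 L E \<and> twoP3_free L E \<and> P_free 4 M E \<and> twoP3_free M E \<and>
      (\<forall>l\<in>L. \<exists>a\<in>A. E l a) \<and>
      (k::nat) \<ge> 3 \<and>
      M = (\<Union>i\<in>{1..k}. Ms i) \<and> B = (\<Union>i\<in>{1..k}. Bs i) \<and>
      (\<forall>i\<in>{1..k}. Ms i \<noteq> {} \<and> Bs i \<noteq> {}) \<and>
      (\<forall>i\<in>{1..k}. \<forall>j\<in>{1..k}. i \<noteq> j \<longrightarrow>
          Ms i \<inter> Ms j = {} \<and> Bs i \<inter> Bs j = {} \<and> anticomplete_to E (Ms i) (Ms j)) \<and>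
      (\<forall>i\<in>{1..k}. \<forall>m\<in>Ms i. (\<exists>b\<in>Bs i. E m b) \<and> (\<forall>b\<in>B - Bs i. \<not> E m b)) \<and>
      (\<forall>b\<in>B. \<exists>m\<in>M. E b m) \<and>
      complete_to E A (Ms 1 \<union> Bs 1 \<union> Ms 2 \<union> Bs 2) \<and>
      (\<forall>i\<in>{3..k}. \<forall>a\<in>A. complete_to E {a} (Ms i \<union> Bs i) \<or>
                             anticomplete_to E {a} (Ms i \<union> Bs i)) \<and>
      (\<forall>a\<in>A. \<not> complete_to E {a} B))"

end

theory Submission
  imports Defs
begin

text \<open>Only the absence of induced squares is needed. It makes the neighborhoods in the clique B of
adjacent vertices of M nested, and those of non-adjacent ones disjoint; the same holds for L and the clique A,
and the neighborhoods in B of the vertices of A form a chain.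
Given C colors with C at least 5/4 of the clique number, color B injectively. The vertices of Q must
reuse the colors of some set S of vertices of B, so that enough colors are left for M; the vertices of A
outside some set U get colors not used on B, which they share with L, while those of U reuse
colors of B - S. Then M and L can be colored greedily. If S and U are chosen minimal, they are exhausted by disjoint
tight neighborhoods, and each of these yields a clique; weighing the resulting
bounds shows that S is no larger than Q and that U can be matched into non-neighbors in B - S.\<close>

section \<open>Induced squares and laminar hitting sets\<close>

lemma C4_free_square:
  assumes "C_free 4 V E" "graph V E"
    and "{a, b, c, d} \<subseteq> V" "E a b" "E b c" "E c d" "E d a" "a \<noteq> c" "b \<noteq> d"
  shows "E a c \<or> E b d"
proof (rule ccontr)
  assume neg: "\<not> (E a c \<or> E b d)"
  define f where "f = (\<lambda>i::nat. if i = 0 then a else if i = 1 then b else if i = 2 then c else d)"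
  have sym: "E u v \<Longrightarrow> E v u" and irr: "\<not> E v v" for u v
    using assms(2) by (auto simp: graph_def)
  have four: "{0..<4::nat} = {0, 1, 2, 3}" by auto
  have ne: "a \<noteq> b" "b \<noteq> c" "c \<noteq> d" "d \<noteq> a" using assms irr by metis+
  have "inj_on f {0..<4}"
    unfolding four using ne assms(8,9) by (auto simp: inj_on_def f_def)
  moreover have "f ` {0..<4} \<subseteq> V"
    unfolding four using assms(3) by (auto simp: f_def)
  moreover have "E (f i) (f j) \<longleftrightarrow> cycle_pat 4 i j" if ij: "i < 4" "j < 4" "i \<noteq> j" for i j
  proof -
    have edges: "E a b" "E b a" "E b c" "E c b" "E c d" "E d c" "E d a" "E a d"
      "\<not> E a c" "\<not> E c a" "\<not> E b d" "\<not> E d b"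
      using neg assms(4-7) sym by blast+
    have "i = 0 \<or> i = 1 \<or> i = 2 \<or> i = 3" "j = 0 \<or> j = 1 \<or> j = 2 \<or> j = 3" using ij by auto
    then show ?thesis
      by (elim disjE) (use ij(3) in \<open>simp_all add: f_def cycle_pat_def edges\<close>)
  qed
  ultimately have "has_induced V E 4 (cycle_pat 4)" unfolding has_induced_def by blast
  then show False using assms(1) by blast
qed

text \<open>The set S hits every N i so that at most h i elements remain. It is chosen of minimal weight, so
its elements lie in tight sets, and the maximal ones among these are disjoint: t counts those meeting D.
The weights matter only for tight sets that properly contain D, from which S takes the elements
outside D first.\<close>

lemma laminar_cover:
  fixes N :: "'i \<Rightarrow> 'a set" and h :: "'i \<Rightarrow> int" and w :: "'a \<Rightarrow> nat" and g :: int
  assumes fin: "finite Y" and NY: "\<And>i. i \<in> I \<Longrightarrow> N i \<subseteq> Y"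
    and lam: "\<And>i j. \<lbrakk>i \<in> I; j \<in> I; N i \<inter> N j \<noteq> {}\<rbrakk> \<Longrightarrow> N i \<subseteq> N j \<or> N j \<subseteq> N i"
    and h: "\<And>i. i \<in> I \<Longrightarrow> g \<le> h i" and g: "0 \<le> g" and w: "\<And>x. 0 < w x"
  obtains S where "S \<subseteq> Y" and "\<forall>i\<in>I. int (card (N i - S)) \<le> h i"
    and "\<forall>D y. D \<subseteq> Y \<longrightarrow>
      (\<forall>i\<in>I. N i \<inter> D = {} \<or> N i \<subseteq> D \<or> (D \<subseteq> N i \<and> (\<forall>x\<in>D. \<forall>z\<in>Y-D. w z < w x))) \<longrightarrow>
      (\<forall>i\<in>I. int (card (N i \<inter> D)) - h i \<le> y - g) \<longrightarrow>
      (\<exists>t::nat. int (card (S \<inter> D)) \<le> int t * (y - g) \<and> int (card (S \<inter> D)) \<le> int (card D) - int t * g)"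
proof -
  define P where "P S \<longleftrightarrow> S \<subseteq> Y \<and> (\<forall>i\<in>I. int (card (N i - S)) \<le> h i)" for S
  have PY: "P Y"
  proof -
    have "int (card (N i - Y)) \<le> h i" if "i \<in> I" for i
    proof -
      have "N i - Y = {}" using NY[OF that] by auto
      then have "card (N i - Y) = 0" by (simp only: card.empty)
      then show ?thesis using h[OF that] g by linarith
    qed
    then show ?thesis unfolding P_def by auto
  qed
  obtain S where PS: "P S" and min: "\<And>T. P T \<Longrightarrow> sum w S \<le> sum w T"
    using ex_has_least_nat[of P Y "sum w"] PY by auto
  have SY: "S \<subseteq> Y" and feas: "\<And>i. i \<in> I \<Longrightarrow> int (card (N i - S)) \<le> h i"
    using PS by (auto simp: P_def)
  have finS: "finite S" using SY fin finite_subset by blast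
  have finN: "finite (N i)" if "i \<in> I" for i using NY[OF that] fin finite_subset by blast
  \<comment> \<open>Trading \<open>x\<close> for a lighter \<open>Z\<close> contradicts minimality,
    so it must break a constraint that \<open>S\<close> satisfies; that constraint is tight, and its
    set contains \<open>x\<close> and misses \<open>Z\<close>.\<close>
  have tight: "\<exists>i\<in>I. x \<in> N i \<and> N i \<inter> Z = {} \<and> int (card (N i - S)) = h i"
    if x: "x \<in> S" and Z: "Z \<subseteq> Y" "Z \<inter> S = {}" and wZ: "sum w Z < w x" for x Z
  proof -
    let ?T = "S - {x} \<union> Z"
    have finZ: "finite Z" using Z fin finite_subset by blast
    have "sum w ?T = sum w (S - {x}) + sum w Z"
      using Z finS finZ by (intro sum.union_disjoint) auto
    moreover have "sum w S = w x + sum w (S - {x})" using x finS by (simp add: sum.remove)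
    ultimately have "sum w ?T < sum w S" using wZ by simp
    then have "\<not> P ?T" using min[of ?T] by linarith
    then obtain i where i: "i \<in> I" "h i < int (card (N i - ?T))"
      using SY Z unfolding P_def by (auto simp: not_le)
    have f: "finite (N i)" using finN i by blast
    have xi: "x \<in> N i"
    proof (rule ccontr)
      assume "x \<notin> N i"
      then have "card (N i - ?T) \<le> card (N i - S)" using f by (intro card_mono) auto
      then show False using i feas[OF i(1)] by linarith
    qed
    have le: "card (N i - ?T) \<le> card (insert x (N i - S))" using f by (intro card_mono) auto
    have ins: "card (insert x (N i - S)) = Suc (card (N i - S))" using f x by simp
    have Zi: "N i \<inter> Z = {}"
    proof (rule ccontr)
      assume "N i \<inter> Z \<noteq> {}"
      then obtain z where "z \<in> N i" "z \<in> Z" by auto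
      moreover have "z \<notin> S" using \<open>z \<in> Z\<close> Z by auto
      ultimately have "N i - ?T \<subset> insert x (N i - S)" using x by auto
      then have "card (N i - ?T) < card (insert x (N i - S))" using f by (intro psubset_card_mono) auto
      then show False using ins i feas[OF i(1)] by linarith
    qed
    have "int (card (N i - S)) = h i" using le ins i feas[OF i(1)] by linarith
    then show ?thesis using i xi Zi by blast
  qed
  have "\<exists>t::nat. int (card (S \<inter> D)) \<le> int t * (y - g) \<and> int (card (S \<inter> D)) \<le> int (card D) - int t * g"
    if DY: "D \<subseteq> Y"
      and D: "\<And>i. i \<in> I \<Longrightarrow> N i \<inter> D = {} \<or> N i \<subseteq> D \<or> (D \<subseteq> N i \<and> (\<forall>x\<in>D. \<forall>z\<in>Y-D. w z < w x))"
      and y: "\<And>i. i \<in> I \<Longrightarrow> int (card (N i \<inter> D)) - h i \<le> y - g" for D y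
  proof -
    have finD: "finite D" using DY fin finite_subset by blast
    \<comment> \<open>Tightness is measured inside \<open>D\<close>. For a set reaching beyond
      \<open>D\<close> it agrees with ordinary tightness once \<open>S\<close> contains the part
      outside \<open>D\<close>.\<close>
    define T where "T = {X. \<exists>i\<in>I. X = N i \<and> int (card (N i \<inter> D - S)) = h i}"
    have TY: "X \<subseteq> Y" if "X \<in> T" for X using that NY by (auto simp: T_def)
    have finT: "finite T"
      using TY fin by (intro finite_subset[of T "Pow Y"]) auto
    have cov: "\<exists>X\<in>T. x \<in> X" if x: "x \<in> S" "x \<in> D" for x
    proof -
      \<comment> \<open>Exchanging x for a lighter element of a smallest tight set around x would be feasible.\<close>
      let ?t = "\<lambda>i. i \<in> I \<and> x \<in> N i \<and> int (card (N i - S)) = h i"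
      obtain i0 where "?t i0" using tight[of x "{}"] x w[of x] by auto
      then obtain i where i: "?t i" and imin: "\<And>j. ?t j \<Longrightarrow> card (N i) \<le> card (N j)"
        using ex_has_least_nat[of ?t i0 "\<lambda>i. card (N i)"] by auto
      have "N i - D \<subseteq> S"
      proof
        fix z assume z: "z \<in> N i - D"
        show "z \<in> S"
        proof (rule ccontr)
          assume zS: "z \<notin> S"
          have zY: "z \<in> Y" using z NY i by auto
          have "w z < w x" using D[of i] i z zY x by blast
          then obtain j where j: "j \<in> I" "x \<in> N j" "z \<notin> N j" "int (card (N j - S)) = h j"
            using tight[of x "{z}"] x zS zY by auto
          then have "N j \<subset> N i" using lam[of i j] i z by blast
          then have "card (N j) < card (N i)" using finN i by (intro psubset_card_mono) auto
          then show False using imin[of j] j by auto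
        qed
      qed
      then have "N i - S = N i \<inter> D - S" by auto
      then have "N i \<in> T" using i by (auto simp: T_def)
      then show ?thesis using i by auto
    qed
    \<comment> \<open>The maximal sets of \<open>T\<close> that meet \<open>S\<close> inside
      \<open>D\<close> are pairwise disjoint by laminarity and cover \<open>S \<inter> D\<close>;
      their number is the witness for \<open>t\<close>.\<close>
    define G where "G = {X \<in> T. X \<inter> (S \<inter> D) \<noteq> {} \<and> (\<forall>X'\<in>T. X \<subseteq> X' \<longrightarrow> X' = X)}"
    have finG: "finite G" using finT by (auto simp: G_def)
    have Gcov: "S \<inter> D \<subseteq> \<Union>G"
    proof
      fix x assume x: "x \<in> S \<inter> D"
      then obtain X where X: "X \<in> T" "x \<in> X" using cov by auto
      obtain X' where X': "X' \<in> T" "X \<subseteq> X'" "\<And>X''. X'' \<in> T \<Longrightarrow> X' \<subseteq> X'' \<Longrightarrow> X'' = X'"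
        using finite_has_maximal2[OF finT X(1)] by metis
      then have "X' \<in> G" using x X by (auto simp: G_def)
      then show "x \<in> \<Union>G" using X X' by auto
    qed
    have Gdis: "X \<inter> X' = {}" if "X \<in> G" "X' \<in> G" "X \<noteq> X'" for X X'
    proof (rule ccontr)
      assume ne: "X \<inter> X' \<noteq> {}"
      have "X \<in> T" "X' \<in> T" using that by (auto simp: G_def)
      then have "X \<subseteq> X' \<or> X' \<subseteq> X" using lam ne by (auto simp: T_def)
      then show False using that by (auto simp: G_def)
    qed
    \<comment> \<open>Exactly \<open>h i\<close> elements of \<open>N i \<inter> D\<close> avoid
      \<open>S\<close>, so \<open>S\<close> takes \<open>card (N i \<inter> D) - h i\<close>
      elements there. The excess bound \<open>y - g\<close> and \<open>g \<le> h i\<close> then give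
      the two estimates, which are summed over \<open>G\<close>.\<close>
    have b: "int (card (S \<inter> D \<inter> X)) \<le> y - g" "int (card (S \<inter> D \<inter> X)) \<le> int (card (D \<inter> X)) - g"
      if XG: "X \<in> G" for X
    proof -
      obtain i where i: "i \<in> I" "X = N i" "int (card (N i \<inter> D - S)) = h i"
        using XG unfolding G_def T_def by blast
      have "N i \<inter> D = (N i \<inter> D - S) \<union> (S \<inter> D \<inter> X)" using i by auto
      then have "card (N i \<inter> D) = card ((N i \<inter> D - S) \<union> (S \<inter> D \<inter> X))" by simp
      also have "\<dots> = card (N i \<inter> D - S) + card (S \<inter> D \<inter> X)"
        using finD by (intro card_Un_disjoint) auto
      finally have eq: "int (card (N i \<inter> D)) = h i + int (card (S \<inter> D \<inter> X))" using i by simp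
      have DX: "D \<inter> X = N i \<inter> D" using i by auto
      show "int (card (S \<inter> D \<inter> X)) \<le> y - g" using eq y[OF i(1)] by simp
      show "int (card (S \<inter> D \<inter> X)) \<le> int (card (D \<inter> X)) - g" using eq h[OF i(1)] DX by simp
    qed
    have part: "card (Z \<inter> \<Union>G) = (\<Sum>X\<in>G. card (Z \<inter> X))" if "finite Z" for Z
    proof -
      have "Z \<inter> \<Union>G = (\<Union>X\<in>G. Z \<inter> X)" by auto
      then show ?thesis using that finG Gdis by (simp only:) (intro card_UN_disjoint, auto)
    qed
    have "card (S \<inter> D) = (\<Sum>X\<in>G. card (S \<inter> D \<inter> X))"
      using part[of "S \<inter> D"] Gcov finD by (simp add: Int_absorb2)
    then have sum: "int (card (S \<inter> D)) = (\<Sum>X\<in>G. int (card (S \<inter> D \<inter> X)))" by simp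
    have "\<dots> \<le> (\<Sum>X\<in>G. y - g)" using b(1) by (rule sum_mono)
    then have 1: "int (card (S \<inter> D)) \<le> int (card G) * (y - g)" using sum by simp
    have "(\<Sum>X\<in>G. int (card (S \<inter> D \<inter> X))) \<le> (\<Sum>X\<in>G. int (card (D \<inter> X)) - g)"
      using b(2) by (rule sum_mono)
    also have "\<dots> = int (card (D \<inter> \<Union>G)) - int (card G) * g"
      using part[OF finD] by (simp add: sum_subtractf)
    also have "\<dots> \<le> int (card D) - int (card G) * g"
      using finD by (simp add: card_mono)
    finally have 2: "int (card (S \<inter> D)) \<le> int (card D) - int (card G) * g" using sum by simp
    show ?thesis using 1 2 by blast
  qed
  then show thesis using SY feas by (intro that[of S]) simp_all
qed

section \<open>Greedy list coloring and matching into a chain\<close>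

text \<open>A list-coloring principle, meant for M over B and for L over A. \<open>P x\<close> is
  the palette of \<open>x\<close>, and \<open>Y\<close> collects the colored vertices that still
  have to be avoided. Coloring a simplicial vertex last leaves only a clique and its common
  neighbors to avoid, which \<open>bound\<close> allows for. \<open>X0\<close> and \<open>Y0\<close>
  stay fixed while \<open>X\<close> shrinks in the induction, so the hypotheses are
  inherited.\<close>

lemma greedy_extension:
  fixes c :: "'a \<Rightarrow> nat"
  assumes finX0: "finite X0" and finY0: "finite Y0" and YY: "Y \<subseteq> Y0"
    and sym: "\<And>u v. E u v \<Longrightarrow> E v u" and irr: "\<And>v. \<not> E v v"
    and nested: "\<And>x x' y y'. \<lbrakk>x \<in> X0; x' \<in> X0; E x x'; y \<in> Y0; y' \<in> Y0; E x y; E x' y'\<rbrakk> \<Longrightarrow> E x y' \<or> E x' y"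
    and disj: "\<And>x x' y. \<lbrakk>x \<in> X0; x' \<in> X0; x \<noteq> x'; y \<in> Y0; E x y; E x' y\<rbrakk> \<Longrightarrow> E x x'"
    and nonempty: "\<And>x. x \<in> X0 \<Longrightarrow> \<exists>y\<in>Y0. E x y"
    and bound: "\<And>x K. \<lbrakk>x \<in> K; K \<subseteq> X0; clique E K\<rbrakk> \<Longrightarrow> card K + card {y \<in> Y. \<forall>k\<in>K. E k y} \<le> card (P x)"
    and X: "X \<subseteq> X0"
  shows "\<exists>f. (\<forall>x\<in>X. f x \<in> P x) \<and> (\<forall>x\<in>X. \<forall>x'\<in>X. E x x' \<longrightarrow> f x \<noteq> f x') \<and>
     (\<forall>x\<in>X. \<forall>y\<in>Y. E x y \<longrightarrow> f x \<noteq> c y)"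
proof -
  have "finite X" using X finX0 finite_subset by blast
  then show ?thesis using X
  proof (induction X rule: finite_psubset_induct)
    case (psubset X)
    show ?case
    proof (cases "X = {}")
      case False
      let ?N = "\<lambda>x. {y \<in> Y0. E x y}"
      \<comment> \<open>A vertex with fewest neighbors in Y0 is simplicial in the union of X and Y0.\<close>
      obtain x where x: "x \<in> X" and min: "\<And>x'. x' \<in> X \<Longrightarrow> card (?N x) \<le> card (?N x')"
      proof -
        obtain z where "z \<in> X" using False by auto
        then show ?thesis
          using that ex_has_least_nat[of "\<lambda>x. x \<in> X" z "\<lambda>x. card (?N x)"] by auto
      qed
      obtain f where f: "\<forall>z\<in>X-{x}. f z \<in> P z" "\<forall>z\<in>X-{x}. \<forall>x'\<in>X-{x}. E z x' \<longrightarrow> f z \<noteq> f x'"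
        "\<forall>z\<in>X-{x}. \<forall>y\<in>Y. E z y \<longrightarrow> f z \<noteq> c y"
      proof -
        have "X - {x} \<subset> X" "X - {x} \<subseteq> X0" using x psubset.prems by auto
        from psubset.IH[OF this] show ?thesis using that by (elim exE conjE)
      qed
      let ?H = "{x' \<in> X. E x x'}"
      let ?K = "insert x ?H"
      have xX0: "x \<in> X0" using x psubset.prems by auto
      have sub: "E x' y" if "x' \<in> ?H" "y \<in> Y0" "E x y" for x' y
      proof (rule ccontr)
        assume n: "\<not> E x' y"
        then have "?N x' \<subset> ?N x" using nested[of x x' y] that x psubset.prems by blast
        then have "card (?N x') < card (?N x)" using finY0 by (intro psubset_card_mono) auto
        then show False using min[of x'] that by auto
      qed
      \<comment> \<open>A neighbor of \<open>x\<close> in \<open>Y0\<close>, which exists by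
        \<open>nonempty\<close>, is shared by all of \<open>?K\<close>; therefore
        \<open>disj\<close> makes \<open>?K\<close> a clique.\<close>
      have cl: "clique E ?K"
        unfolding clique_def
      proof (intro ballI impI)
        fix u v assume uv: "u \<in> ?K" "v \<in> ?K" "u \<noteq> v"
        obtain y where y: "y \<in> Y0" "E x y" using nonempty[OF xX0] by blast
        have ext: "E k y" if "k \<in> ?K" for k using that y(2) sub[OF _ y] by (cases "k = x") simp_all
        have "E u y" "E v y" using uv ext by blast+
        moreover have "u \<in> X0" "v \<in> X0" using uv x psubset.prems by auto
        ultimately show "E u v" using disj[of u v y] uv(3) y(1) by simp
      qed
      have finH: "finite ?H" using psubset.hyps by auto
      let ?Y = "{y \<in> Y. E x y}"
      have finY: "finite ?Y" using YY finY0 by (auto intro: finite_subset)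
      \<comment> \<open>All of \<open>?K\<close> sees \<open>?Y\<close>, so \<open>bound\<close>
        applies to \<open>?K\<close>; since it also counts \<open>x\<close> itself, one color of the
        palette is left over.\<close>
      have "?Y = {y \<in> Y. \<forall>k\<in>?K. E k y}" using sub YY by auto
      then have "card ?K + card ?Y \<le> card (P x)"
        using bound[of x ?K] cl x psubset.prems by auto
      moreover have "card ?K = Suc (card ?H)" using finH irr by simp
      moreover have "card (f ` ?H \<union> c ` ?Y) \<le> card ?H + card ?Y"
        by (rule order_trans[OF card_Un_le]) (intro add_mono card_image_le finH finY)
      ultimately have "card (f ` ?H \<union> c ` ?Y) < card (P x)" by linarith
      then have "\<not> P x \<subseteq> f ` ?H \<union> c ` ?Y"
        using finH finY card_mono[of "f ` ?H \<union> c ` ?Y" "P x"] by auto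
      then obtain p where p: "p \<in> P x" "p \<notin> f ` ?H" "p \<notin> c ` ?Y" by auto
      show ?thesis
      proof (intro exI[of _ "f(x := p)"] conjI ballI impI)
        fix z assume "z \<in> X" then show "(f(x := p)) z \<in> P z" using f p by auto
      next
        fix z z' assume zz: "z \<in> X" "z' \<in> X" "E z z'"
        have "p \<noteq> f v" if "v \<in> X" "E x v" for v using p(2) that by auto
        moreover have "z \<noteq> z'" "E z' z" using zz(3) irr[of z] sym[of z z'] by auto
        ultimately show "(f(x := p)) z \<noteq> (f(x := p)) z'"
          using f(2) zz by (cases "z = x"; cases "z' = x") (auto simp: eq_commute)
      next
        fix z y assume "z \<in> X" "y \<in> Y" "E z y"
        then show "(f(x := p)) z \<noteq> c y" using f(3) p(3) by auto
      qed
    qed auto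
  qed
qed

text \<open>Hall's theorem when the sets \<open>G u\<close> form a chain: a vertex with the largest
  \<open>G u\<close> is matched last, when fewer than \<open>card U\<close> partners are taken. The
  order is governed by \<open>G\<close> while partners come from \<open>F\<close>; in the
  application \<open>F u\<close> is \<open>G u\<close> without the reserved set
  \<open>S\<close>.\<close>

lemma nested_matching:
  assumes "finite U" and "\<And>u. u \<in> U \<Longrightarrow> finite (G u)" and "\<And>u. u \<in> U \<Longrightarrow> F u \<subseteq> G u"
    and "\<And>u v. \<lbrakk>u \<in> U; v \<in> U\<rbrakk> \<Longrightarrow> G u \<subseteq> G v \<or> G v \<subseteq> G u"
    and "\<And>u. u \<in> U \<Longrightarrow> card {v \<in> U. G v \<subseteq> G u} \<le> card (F u)"
  shows "\<exists>f. inj_on f U \<and> (\<forall>u\<in>U. f u \<in> F u)"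
  using assms
proof (induction U rule: finite_psubset_induct)
  case (psubset U)
  show ?case
  proof (cases "U = {}")
    case False
    obtain u where u: "u \<in> U" and max: "\<And>v. v \<in> U \<Longrightarrow> card (G v) \<le> card (G u)"
    proof -
      have "Max ((\<lambda>v. card (G v)) ` U) \<in> (\<lambda>v. card (G v)) ` U"
        using False psubset.hyps by (intro Max_in) auto
      then obtain u where "u \<in> U" "card (G u) = Max ((\<lambda>v. card (G v)) ` U)" by auto
      then show ?thesis using that psubset.hyps by auto
    qed
    have sub: "G v \<subseteq> G u" if "v \<in> U" for v
      using psubset.prems(3)[OF that u] max[OF that] psubset.prems(1)[OF that] card_seteq by blast
    have "\<exists>f. inj_on f (U - {u}) \<and> (\<forall>v\<in>U - {u}. f v \<in> F v)"
    proof (rule psubset.IH)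
      fix v assume v: "v \<in> U - {u}"
      have "card {x \<in> U - {u}. G x \<subseteq> G v} \<le> card {x \<in> U. G x \<subseteq> G v}"
        using psubset.hyps by (intro card_mono) auto
      then show "card {x \<in> U - {u}. G x \<subseteq> G v} \<le> card (F v)" using psubset.prems(4) v
        by (meson DiffD1 order_trans)
    qed (use u psubset.prems in auto)
    then obtain f where f: "inj_on f (U - {u})" "\<forall>v\<in>U - {u}. f v \<in> F v" by blast
    have "{v \<in> U. G v \<subseteq> G u} = U" using sub by auto
    then have "card U \<le> card (F u)" using psubset.prems(4)[OF u] by simp
    moreover have "card (f ` (U - {u})) < card U"
      using card_image_le[of "U - {u}" f] psubset.hyps u
      by (meson card_Diff1_less finite_Diff le_less_trans)
    ultimately have "\<not> F u \<subseteq> f ` (U - {u})"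
      using card_mono[of "f ` (U - {u})" "F u"] psubset.hyps by auto
    then obtain p where p: "p \<in> F u" "p \<notin> f ` (U - {u})" by auto
    have "inj_on (f(u := p)) U" using f(1) p(2) u
      by (auto simp: inj_on_def)
    moreover have "\<forall>v\<in>U. (f(u := p)) v \<in> F v" using f(2) p(1) by simp
    ultimately show ?thesis by blast
  qed auto
qed

section \<open>Arithmetic of the tight sets\<close>

text \<open>Here \<open>t\<close> counts disjoint tight sets. Four or more push the second bound
  down to \<open>w - 4 * g \<le> 0\<close>; for \<open>t\<close> equal to 2 or 3 a convex
  combination of the two bounds is at most \<open>q\<close>, and for smaller \<open>t\<close> the
  first one suffices.\<close>

lemma reserve_bound:
  fixes s q w g :: int and t :: nat
  assumes "s \<le> int t * (q - g)" "s \<le> w - int t * g" "w \<le> 4 * g" "0 \<le> g" "0 \<le> q"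
  shows "s \<le> q"
proof -
  consider "t = 0" | "t = 1" | "t = 2" | "t = 3" | "4 \<le> t" by linarith
  then show ?thesis
  proof cases
    case 5
    then have "4 * g \<le> int t * g" using assms(4) by (intro mult_right_mono) auto
    then show ?thesis using assms by linarith
  qed (use assms in auto)
qed

text \<open>Here \<open>p\<close> and \<open>t\<close> count tight neighborhoods in A and in B. If
  \<open>p + t \<ge> 4\<close>, adding the two second bounds is enough; the few remaining cases are
  linear.\<close>

lemma matching_bound:
  fixes u s q w g z :: int and p t :: nat
  assumes u: "u \<le> int p * (z - g)" "u \<le> w - q - int p * g"
    and s: "s \<le> int t * (q - g)" "s \<le> z - int t * g"
    and "w \<le> 4 * g" "0 \<le> g" "0 \<le> q" "0 \<le> z"
  shows "u + s \<le> z"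
proof (cases "4 \<le> p + t")
  case True
  then have "4 * g \<le> (int p + int t) * g" using assms(6) by (intro mult_right_mono) auto
  then show ?thesis using assms by (simp add: distrib_right)
next
  case False
  then have "p = 0 \<or> p = 1 \<and> (t = 0 \<or> t = 1 \<or> t = 2) \<or> p = 2 \<and> (t = 0 \<or> t = 1) \<or> p = 3 \<and> t = 0"
    by linarith
  then consider "p = 0" | "p = 1" "t = 0" | "p = 1" "t = 1" | "p = 1" "t = 2"
    | "p = 2" "t = 0" | "p = 2" "t = 1" | "p = 3" "t = 0" by blast
  then show ?thesis
  proof cases
    case 1
    have "0 \<le> int t * g" using assms(6) by simp
    then show ?thesis using u(1) s(2) 1 by simp
  qed (use assms in auto)
qed

section \<open>Neighborhoods in a boiler\<close>

text \<open>\<open>twins\<close> condenses the indexed pieces of M and B: adjacent vertices of M and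
  B belong to pieces with the same index, and a vertex of A sees both of them or neither.\<close>

locale boiler_core =
  fixes V :: "'a set" and E :: "'a \<Rightarrow> 'a \<Rightarrow> bool" and Q A B L M :: "'a set"
  assumes finV: "finite V" and sym: "E u v \<Longrightarrow> E v u" and irr: "\<not> E v v"
    and square: "\<lbrakk>{a, b, c, d} \<subseteq> V; E a b; E b c; E c d; E d a; a \<noteq> c; b \<noteq> d\<rbrakk> \<Longrightarrow> E a c \<or> E b d"
    and V: "Q \<union> A \<union> B \<union> L \<union> M = V"
    and disjoint: "Q \<inter> A = {}" "Q \<inter> B = {}" "Q \<inter> L = {}" "Q \<inter> M = {}" "A \<inter> B = {}"
      "A \<inter> L = {}" "A \<inter> M = {}" "B \<inter> L = {}" "B \<inter> M = {}" "L \<inter> M = {}"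
    and Q_ne: "Q \<noteq> {}"
    and Qcl: "clique E Q" and Acl: "clique E A" and Bcl: "clique E B"
    and QA: "\<lbrakk>x \<in> Q; y \<in> A\<rbrakk> \<Longrightarrow> E x y" and QM: "\<lbrakk>x \<in> Q; y \<in> M\<rbrakk> \<Longrightarrow> E x y"
    and BL: "\<lbrakk>x \<in> B; y \<in> L\<rbrakk> \<Longrightarrow> E x y"
    and QB: "\<lbrakk>x \<in> Q; y \<in> B\<rbrakk> \<Longrightarrow> \<not> E x y" and QL: "\<lbrakk>x \<in> Q; y \<in> L\<rbrakk> \<Longrightarrow> \<not> E x y"
    and LM: "\<lbrakk>x \<in> L; y \<in> M\<rbrakk> \<Longrightarrow> \<not> E x y"
    and L_nbr: "l \<in> L \<Longrightarrow> \<exists>a\<in>A. E l a" and M_nbr: "m \<in> M \<Longrightarrow> \<exists>b\<in>B. E m b"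
    and A_miss: "a \<in> A \<Longrightarrow> \<exists>b\<in>B. \<not> E a b"
    and twins: "\<lbrakk>a \<in> A; b \<in> B; m \<in> M; E m b\<rbrakk> \<Longrightarrow> E a m \<longleftrightarrow> E a b"
begin

lemma subsets: "Q \<subseteq> V" "A \<subseteq> V" "B \<subseteq> V" "L \<subseteq> V" "M \<subseteq> V"
  using V by auto

lemma fin: "finite Q" "finite A" "finite B" "finite L" "finite M"
  using subsets finV finite_subset by blast+

lemma cliqueD: "\<lbrakk>clique E K; u \<in> K; v \<in> K; u \<noteq> v\<rbrakk> \<Longrightarrow> E u v"
  by (auto simp: clique_def)

text \<open>If both edges were missing, \<open>x'\<close>, \<open>x\<close>, \<open>y\<close>,
  \<open>y'\<close> would form an induced square.\<close>

lemma nested_into_clique: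
  assumes "x \<in> V" "x' \<in> V" "E x x'" "clique E K" "K \<subseteq> V" "y \<in> K" "y' \<in> K" "E x y" "E x' y'"
    "x \<notin> K" "x' \<notin> K"
  shows "E x y' \<or> E x' y"
proof (cases "y = y'")
  case False
  have "E x' x" "E y y'" "E y' x'" using assms sym cliqueD False by blast+
  then show ?thesis using square[of x' x y y'] assms by auto
qed (use assms in auto)

lemma rev_complete: "\<lbrakk>y \<in> M; x \<in> Q\<rbrakk> \<Longrightarrow> E y x" "\<lbrakk>y \<in> L; x \<in> B\<rbrakk> \<Longrightarrow> E y x"
  using QM BL sym by blast+

lemma in_V: "x \<in> Q \<Longrightarrow> x \<in> V" "x \<in> A \<Longrightarrow> x \<in> V" "x \<in> B \<Longrightarrow> x \<in> V" "x \<in> L \<Longrightarrow> x \<in> V" "x \<in> M \<Longrightarrow> x \<in> V"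
  using V by auto

lemma apart: "x \<in> M \<Longrightarrow> x \<notin> B" "x \<in> L \<Longrightarrow> x \<notin> A" "x \<in> A \<Longrightarrow> x \<notin> B" "x \<in> L \<Longrightarrow> x \<notin> B" "x \<in> Q \<Longrightarrow> x \<notin> B"
  using disjoint by auto

lemma M_nested:
  "\<lbrakk>x \<in> M; x' \<in> M; E x x'; y \<in> B; y' \<in> B; E x y; E x' y'\<rbrakk> \<Longrightarrow> E x y' \<or> E x' y"
  using nested_into_clique[of x x' B y y'] Bcl subsets(3) in_V(5) apart(1) by simp

lemma L_nested:
  "\<lbrakk>x \<in> L; x' \<in> L; E x x'; y \<in> A; y' \<in> A; E x y; E x' y'\<rbrakk> \<Longrightarrow> E x y' \<or> E x' y"
  using nested_into_clique[of x x' A y y'] Acl subsets(2) in_V(4) apart(2) by simp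

lemma A_nested:
  "\<lbrakk>x \<in> A; x' \<in> A; y \<in> B; y' \<in> B; E x y; E x' y'\<rbrakk> \<Longrightarrow> E x y' \<or> E x' y"
  using nested_into_clique[of x x' B y y'] Bcl subsets(3) in_V(2) apart(3) cliqueD[OF Acl, of x x']
  by (cases "x = x'") simp_all

text \<open>Otherwise any vertex of \<open>Q\<close>, complete to \<open>M\<close> and anticomplete
  to \<open>B\<close>, closes an induced square through \<open>x\<close>, \<open>y\<close>,
  \<open>x'\<close>.\<close>

lemma M_disjoint:
  assumes "x \<in> M" "x' \<in> M" "x \<noteq> x'" "y \<in> B" "E x y" "E x' y"
  shows "E x x'"
proof -
  obtain q where q: "q \<in> Q" using Q_ne by auto
  have "E y x'" "E x' q" "E q x" "y \<noteq> q" "\<not> E y q"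
    using assms q QM rev_complete apart(5) sym[of x' y] sym[of y q] QB by auto
  then show ?thesis using square[of x y x' q] assms q in_V by simp
qed

text \<open>The vertex closing the square is now a non-neighbor of \<open>y\<close> in
  \<open>B\<close>, supplied by \<open>A_miss\<close>.\<close>

lemma L_disjoint:
  assumes "x \<in> L" "x' \<in> L" "x \<noteq> x'" "y \<in> A" "E x y" "E x' y"
  shows "E x x'"
proof -
  obtain b where b: "b \<in> B" "\<not> E y b" using A_miss assms by blast
  have "E y x'" "E x' b" "E b x" "y \<noteq> b"
    using assms b sym[of x' y] rev_complete BL apart(3) by auto
  then show ?thesis using square[of x y x' b] assms b in_V by simp
qed

text \<open>Capacities will be imposed on cliques, so common neighborhoods of sets are compared
  instead of neighborhoods of single vertices. If neither contains the other, the witnesses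
  \<open>k\<close> and \<open>k'\<close> share a neighbor, hence are adjacent, and nestedness fails
  for them.\<close>

lemma common_laminar:
  assumes nested: "\<And>x x' y y'. \<lbrakk>x \<in> X; x' \<in> X; E x x'; y \<in> Y; y' \<in> Y; E x y; E x' y'\<rbrakk> \<Longrightarrow> E x y' \<or> E x' y"
    and disj: "\<And>x x' y. \<lbrakk>x \<in> X; x' \<in> X; x \<noteq> x'; y \<in> Y; E x y; E x' y\<rbrakk> \<Longrightarrow> E x x'"
    and K: "K \<subseteq> X" "K' \<subseteq> X" and ne: "{y \<in> Y. \<forall>k\<in>K. E k y} \<inter> {y \<in> Y. \<forall>k\<in>K'. E k y} \<noteq> {}"
  shows "{y \<in> Y. \<forall>k\<in>K. E k y} \<subseteq> {y \<in> Y. \<forall>k\<in>K'. E k y} \<or> {y \<in> Y. \<forall>k\<in>K'. E k y} \<subseteq> {y \<in> Y. \<forall>k\<in>K. E k y}"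
proof (rule ccontr)
  assume "\<not> ?thesis"
  then obtain y y' k k' where y: "y \<in> Y" "\<forall>k\<in>K. E k y" "k' \<in> K'" "\<not> E k' y"
    "y' \<in> Y" "\<forall>k\<in>K'. E k y'" "k \<in> K" "\<not> E k y'" by blast
  obtain z where z: "z \<in> Y" "E k z" "E k' z" using ne y by blast
  have X: "k \<in> X" "k' \<in> X" using y K by auto
  have "k \<noteq> k'" using y by auto
  then have "E k k'" using disj X z by blast
  then show False using nested[of k k' y y'] X y by auto
qed

text \<open>A counterexample yields \<open>a\<close> in the common neighborhood not adjacent to a
  neighbor \<open>b\<close> of \<open>u\<close>, and \<open>a'\<close> in \<open>D\<close> not
  adjacent to some \<open>k\<close> in \<open>K\<close>; then \<open>a'\<close>, \<open>a\<close>,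
  \<open>k\<close>, \<open>b\<close> is an induced square. This prepares \<open>D\<close> for use in
  \<open>laminar_cover\<close>.\<close>

lemma L_A_comparable:
  assumes u: "u \<in> A" and K: "K \<subseteq> L"
  defines "D \<equiv> {a \<in> A. \<forall>b\<in>B. E u b \<longrightarrow> E a b}"
  shows "{a \<in> A. \<forall>k\<in>K. E k a} \<subseteq> D \<or> D \<subseteq> {a \<in> A. \<forall>k\<in>K. E k a}"
proof (rule ccontr)
  assume "\<not> ?thesis"
  then obtain a a' b k where a: "a \<in> A" "\<forall>k\<in>K. E k a" "b \<in> B" "E u b" "\<not> E a b"
    "a' \<in> A" "E a' b" "k \<in> K" "\<not> E k a'" unfolding D_def by blast
  have k: "k \<in> L" using a K by auto
  have "a \<noteq> a'" using a by auto
  then have "E a' a" "E a k" "E k b" "E b a'" "\<not> E a' k"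
    using a k sym[of k a] sym[of a' b] sym[of a' k] cliqueD[OF Acl, of a' a] rev_complete by auto
  moreover have "a' \<noteq> k" "a \<noteq> b" using a(1,3,6) k apart by auto
  ultimately show False using square[of a' a k b] a(1,3,5,6) k in_V by simp
qed

lemma clique_Un:
  assumes "clique E X" "clique E Y" "\<And>x y. \<lbrakk>x \<in> X; y \<in> Y\<rbrakk> \<Longrightarrow> E x y"
  shows "clique E (X \<union> Y)"
  unfolding clique_def
proof (intro ballI impI)
  fix u v assume uv: "u \<in> X \<union> Y" "v \<in> X \<union> Y" "u \<noteq> v"
  show "E u v"
  proof (cases "u \<in> X")
    case True
    then show ?thesis using uv assms(3) cliqueD[OF assms(1)] by auto
  next
    case False
    then show ?thesis using uv assms(3) sym[of v u] cliqueD[OF assms(2)] by auto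
  qed
qed

lemma disjoint_subsets: "\<lbrakk>X \<subseteq> X'; Y \<subseteq> Y'; X' \<inter> Y' = {}\<rbrakk> \<Longrightarrow> X \<inter> Y = {}"
  by blast

lemma disjoint': "M \<inter> Q = {}" "M \<inter> A = {}" "M \<inter> B = {}" "L \<inter> A = {}" "L \<inter> B = {}"
  using disjoint by (simp_all add: Int_commute)

section \<open>The coloring\<close>

lemma coloring:
  fixes w C :: nat
  assumes w: "\<And>K. \<lbrakk>K \<subseteq> V; clique E K\<rbrakk> \<Longrightarrow> card K \<le> w"
    and C: "5 * w \<le> 4 * C"
  shows "\<exists>c :: 'a \<Rightarrow> nat. (\<forall>v\<in>V. c v < C) \<and> (\<forall>u\<in>V. \<forall>v\<in>V. E u v \<longrightarrow> c u \<noteq> c v)"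
proof -
  \<comment> \<open>NB and NA give common neighborhoods, so those of the empty set are all of B and A.\<close>
  define g where "g = int C - int w"
  \<comment> \<open>\<open>g\<close> is the surplus of colors over the clique bound; the ratio 5/4
    reaches \<open>reserve_bound\<close> and \<open>matching_bound\<close> in the form
    \<open>w \<le> 4 * g\<close>.\<close>
  have g: "int w \<le> 4 * g" "0 \<le> g" using C by (auto simp: g_def)
  define q where "q = int (card Q)"
  define NB where "NB K = {b \<in> B. \<forall>k\<in>K. E k b}" for K
  define NA where "NA K = {a \<in> A. \<forall>k\<in>K. E k a}" for K
  have w2: "card X + card Y \<le> w"
    if "X \<subseteq> V" "Y \<subseteq> V" "clique E X" "clique E Y" "X \<inter> Y = {}" "\<And>x y. x \<in> X \<Longrightarrow> y \<in> Y \<Longrightarrow> E x y" for X Y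
  proof -
    have "clique E (X \<union> Y)" using that by (intro clique_Un) auto
    moreover have "card (X \<union> Y) = card X + card Y"
      using that finite_subset[OF _ finV] by (intro card_Un_disjoint) simp_all
    ultimately show ?thesis using w[of "X \<union> Y"] that(1,2) by simp
  qed
  have w3: "card X + card Y + card Z \<le> w"
    if "X \<subseteq> V" "Y \<subseteq> V" "Z \<subseteq> V" "clique E X" "clique E Y" "clique E Z"
      "X \<inter> Y = {}" "X \<inter> Z = {}" "Y \<inter> Z = {}" "\<And>x y. x \<in> X \<Longrightarrow> y \<in> Y \<Longrightarrow> E x y"
      "\<And>x y. x \<in> X \<Longrightarrow> y \<in> Z \<Longrightarrow> E x y" "\<And>x y. x \<in> Y \<Longrightarrow> y \<in> Z \<Longrightarrow> E x y" for X Y Z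
  proof -
    have cl: "clique E (X \<union> Y)" using that(4,5,10) by (rule clique_Un)
    have "card (X \<union> Y) + card Z \<le> w"
      by (rule w2[OF _ that(3) cl that(6)]) (use that(1,2,8,9,11,12) in auto)
    moreover have "card (X \<union> Y) = card X + card Y"
      using that(1,2,7) finite_subset[OF _ finV] by (intro card_Un_disjoint) simp_all
    ultimately show ?thesis by simp
  qed
  have sub_cl: "clique E K'" if "clique E K" "K' \<subseteq> K" for K K' using that by (auto simp: clique_def)
  have NAcl: "clique E (NA K)" "NA K \<subseteq> A" and NBcl: "clique E (NB K)" "NB K \<subseteq> B" for K
    using Acl Bcl sub_cl by (auto simp: NA_def NB_def)
  \<comment> \<open>Adjacent vertices of \<open>M\<close> have a common neighbor in \<open>B\<close>
    by \<open>M_nested\<close>, so \<open>twins\<close> gives them the same neighbors in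
    \<open>A\<close>.\<close>
  have NA_eq: "NA K = {a \<in> A. E m a}" if K: "K \<subseteq> M" "clique E K" "m \<in> K" for K m
  proof -
    have "E k a" if a: "a \<in> A" "E m a" and k: "k \<in> K" for a k
    proof (cases "k = m")
      case False
      have mk: "m \<in> M" "k \<in> M" "E m k" using K k False cliqueD by auto
      obtain b b' where b: "b \<in> B" "E m b" "b' \<in> B" "E k b'" using M_nbr mk by meson
      then obtain b'' where b'': "b'' \<in> B" "E m b''" "E k b''" using M_nested[of m k b b'] mk by blast
      show ?thesis
        using twins[of a b'' m] twins[of a b'' k] a mk b'' sym[of a k] sym[of m a] by simp
    qed (use a in auto)
    then show ?thesis using K unfolding NA_def by auto
  qed

  \<comment> \<open>A clique K of M sees the colors of Q and of NA K; hM K bounds how many further colors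
    it may see on B.\<close>
  define IM where "IM = {K. K \<subseteq> M \<and> clique E K \<and> K \<noteq> {}}"
  define hM where "hM K = int C - q - int (card K) - int (card (NA K))" for K
  \<comment> \<open>This clique bound says that \<open>hM K\<close> is at least
    \<open>g\<close>.\<close>
  have KQA: "card K + card Q + card (NA K) \<le> w" if "K \<in> IM" for K
  proof (rule w3)
    have K: "K \<subseteq> M" "clique E K" using that by (auto simp: IM_def)
    show "clique E K" "clique E Q" "clique E (NA K)" using K Qcl NAcl by auto
    show "K \<subseteq> V" "Q \<subseteq> V" "NA K \<subseteq> V"
      using K(1) NAcl(2)[of K] subsets by (auto intro: order_trans)
    show "K \<inter> Q = {}" "K \<inter> NA K = {}" "Q \<inter> NA K = {}"
      by (rule disjoint_subsets[OF K(1) order_refl disjoint'(1)] disjoint_subsets[OF K(1) NAcl(2) disjoint'(2)]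
        disjoint_subsets[OF order_refl NAcl(2) disjoint(1)])+
    show "E x y" if "x \<in> K" "y \<in> Q" for x y using that K rev_complete(1) by blast
    show "E x y" if "x \<in> K" "y \<in> NA K" for x y using that by (simp add: NA_def)
    show "E x y" if "x \<in> Q" "y \<in> NA K" for x y using that QA by (simp add: NA_def)
  qed
  \<comment> \<open>This one bounds the excess \<open>card (NB K) - hM K\<close> by
    \<open>q - g\<close>. The two common neighborhoods are complete to each other by
    \<open>twins\<close>, applied at any vertex of \<open>K\<close>.\<close>
  have KAB: "card K + card (NA K) + card (NB K) \<le> w" if K: "K \<in> IM" for K
  proof (rule w3)
    show "E x y" if "x \<in> NA K" "y \<in> NB K" for x y
    proof -
      obtain m where m: "m \<in> K" "m \<in> M" using K by (auto simp: IM_def)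
      then have "E m x" "E m y" "x \<in> A" "y \<in> B" using that by (auto simp: NA_def NB_def)
      then show ?thesis using twins[of x y m] m(2) sym[of m x] by simp
    qed
    have K': "K \<subseteq> M" "clique E K" using K by (auto simp: IM_def)
    show "clique E K" "clique E (NA K)" "clique E (NB K)" using K' NAcl NBcl by auto
    show "K \<subseteq> V" "NA K \<subseteq> V" "NB K \<subseteq> V"
      using K'(1) NAcl(2)[of K] NBcl(2)[of K] subsets by (auto intro: order_trans)
    show "K \<inter> NA K = {}" "K \<inter> NB K = {}" "NA K \<inter> NB K = {}"
      by (rule disjoint_subsets[OF K'(1) NAcl(2) disjoint'(2)] disjoint_subsets[OF K'(1) NBcl(2) disjoint'(3)]
        disjoint_subsets[OF NAcl(2) NBcl(2) disjoint(5)])+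
  qed (simp_all add: NA_def NB_def)
  \<comment> \<open>By \<open>twins\<close>, \<open>u\<close> sees all or nothing of
    \<open>NB K\<close>; hence the non-neighbors of \<open>u\<close> in \<open>B\<close> can serve
    as \<open>D\<close> in \<open>S_bound\<close>.\<close>
  have NB_class: "NB K \<subseteq> {b \<in> B. \<not> E u b}" if K: "K \<in> IM" and u: "u \<in> A" and ne: "NB K \<inter> {b \<in> B. \<not> E u b} \<noteq> {}" for K u
  proof -
    obtain m where m: "m \<in> K" "m \<in> M" using K by (auto simp: IM_def)
    obtain b where b: "b \<in> B" "E m b" "\<not> E u b" using ne m by (auto simp: NB_def)
    then show ?thesis using twins[of u b m] twins[of u _ m] u m by (auto simp: NB_def)
  qed
  \<comment> \<open>Constant weight makes \<open>S\<close> as small as possible; each later choice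
    of \<open>D\<close> contains \<open>NB K\<close> or is disjoint from it.\<close>
  obtain S where S: "S \<subseteq> B" and S_feas: "\<forall>K\<in>IM. int (card (NB K - S)) \<le> hM K"
    and S_bound0: "\<forall>D y. D \<subseteq> B \<longrightarrow>
      (\<forall>K\<in>IM. NB K \<inter> D = {} \<or> NB K \<subseteq> D \<or> (D \<subseteq> NB K \<and> (\<forall>x\<in>D. \<forall>z\<in>B-D. (1::nat) < 1))) \<longrightarrow>
      (\<forall>K\<in>IM. int (card (NB K \<inter> D)) - hM K \<le> y - g) \<longrightarrow>
      (\<exists>t::nat. int (card (S \<inter> D)) \<le> int t * (y - g) \<and> int (card (S \<inter> D)) \<le> int (card D) - int t * g)"
  proof (rule laminar_cover[of B IM NB g hM "\<lambda>_. 1"])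
    show "finite B" by (rule fin)
    show "NB K \<subseteq> B" for K by (auto simp: NB_def)
    show "NB K \<subseteq> NB K' \<or> NB K' \<subseteq> NB K" if "K \<in> IM" "K' \<in> IM" "NB K \<inter> NB K' \<noteq> {}" for K K'
      unfolding NB_def
      by (rule common_laminar[of M B, OF M_nested M_disjoint]) (use that in \<open>auto simp: IM_def NB_def\<close>)
    show "g \<le> hM K" if "K \<in> IM" for K using KQA[OF that] by (simp add: hM_def g_def q_def)
    show "0 \<le> g" by (rule g)
    show "(0::nat) < 1" by simp
  qed
  have S_bound: "\<exists>t::nat. int (card (S \<inter> D)) \<le> int t * (q - g) \<and> int (card (S \<inter> D)) \<le> int (card D) - int t * g"
    if D: "D \<subseteq> B" "\<forall>i\<in>IM. NB i \<inter> D = {} \<or> NB i \<subseteq> D" for D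
  proof (rule S_bound0[rule_format, OF D(1)])
    fix K assume K: "K \<in> IM"
    show "NB K \<inter> D = {} \<or> NB K \<subseteq> D \<or> (D \<subseteq> NB K \<and> (\<forall>x\<in>D. \<forall>z\<in>B-D. (1::nat) < 1))"
      using D(2) K by blast
    have "card (NB K \<inter> D) \<le> card (NB K)" using fin by (intro card_mono) (auto simp: NB_def)
    then show "int (card (NB K \<inter> D)) - hM K \<le> q - g" using KAB[OF K] by (simp add: hM_def g_def)
  qed
  have Bw: "card B \<le> w" using w subsets Bcl by auto
  have S_q: "card S \<le> card Q"
  proof -
    obtain t :: nat where t: "int (card (S \<inter> B)) \<le> int t * (q - g)" "int (card (S \<inter> B)) \<le> int (card B) - int t * g"
      using S_bound[of B] NBcl by auto
    have "int (card (S \<inter> B)) \<le> q"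
      by (rule reserve_bound[OF t(1), of "int w"]) (use t g Bw in \<open>auto simp: q_def\<close>)
    then show ?thesis using S by (simp add: q_def Int_absorb2)
  qed

  \<comment> \<open>The r colors not used on B serve L and A - U; the weight makes U prefer vertices with few
    neighbors in B, which are the easiest to match.\<close>
  define r where "r = int C - int (card B)"
  define IL where "IL = {K. K \<subseteq> L \<and> clique E K}"
  define wt where "wt a = Suc (card {b \<in> B. E a b})" for a
  define up where "up u = {a \<in> A. \<forall>b\<in>B. E u b \<longrightarrow> E a b}" for u
  have KB: "card K + card B \<le> w" if "K \<in> IL" for K
  proof (rule w2)
    have K: "K \<subseteq> L" "clique E K" using that by (auto simp: IL_def)
    show "K \<subseteq> V" "B \<subseteq> V" using K(1) subsets by auto
    show "clique E K" "clique E B" by (rule K(2) Bcl)+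
    show "K \<inter> B = {}" by (rule disjoint_subsets[OF K(1) order_refl disjoint'(5)])
    show "E x y" if "x \<in> K" "y \<in> B" for x y using that K rev_complete(2) by blast
  qed
  \<comment> \<open>Once \<open>A - U\<close> has been colored injectively with the \<open>r\<close>
    colors, a clique \<open>K\<close> of \<open>L\<close> still needs \<open>card K\<close> of them,
    all different from those on \<open>NA K - U\<close>.\<close>
  obtain U where U: "U \<subseteq> A" and U_feas: "\<forall>K\<in>IL. int (card (NA K - U)) \<le> r - int (card K)"
    and U_bound: "\<forall>D y. D \<subseteq> A \<longrightarrow>
      (\<forall>K\<in>IL. NA K \<inter> D = {} \<or> NA K \<subseteq> D \<or> (D \<subseteq> NA K \<and> (\<forall>x\<in>D. \<forall>z\<in>A-D. wt z < wt x))) \<longrightarrow>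
      (\<forall>K\<in>IL. int (card (NA K \<inter> D)) - (r - int (card K)) \<le> y - g) \<longrightarrow>
      (\<exists>t::nat. int (card (U \<inter> D)) \<le> int t * (y - g) \<and> int (card (U \<inter> D)) \<le> int (card D) - int t * g)"
  proof (rule laminar_cover[of A IL NA g "\<lambda>K. r - int (card K)" wt])
    show "finite A" by (rule fin)
    show "NA K \<subseteq> A" for K by (auto simp: NA_def)
    show "NA K \<subseteq> NA K' \<or> NA K' \<subseteq> NA K" if "K \<in> IL" "K' \<in> IL" "NA K \<inter> NA K' \<noteq> {}" for K K'
      unfolding NA_def
      by (rule common_laminar[of L A, OF L_nested L_disjoint]) (use that in \<open>auto simp: IL_def NA_def\<close>)
    show "g \<le> r - int (card K)" if "K \<in> IL" for K using KB[OF that] by (simp add: r_def g_def)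
    show "0 \<le> g" by (rule g)
    show "0 < wt a" for a by (simp add: wt_def)
  qed
  have QAw: "card Q + card A \<le> w" using subsets(1,2) Qcl Acl disjoint(1) QA by (rule w2)

  \<comment> \<open>Hall's condition: the vertices of \<open>U\<close> whose non-neighbors in
    \<open>B\<close> all lie in \<open>?Z\<close> are those of \<open>U \<inter> up u\<close>. The
    losses are controlled by the cover bounds, with \<open>D\<close> equal to \<open>?Z\<close> for
    \<open>S\<close> and to \<open>up u\<close> for \<open>U\<close>.\<close>
  have hall: "card (U \<inter> up u) \<le> card ({b \<in> B. \<not> E u b} - S)" if u: "u \<in> A" for u
  proof -
    let ?Z = "{b \<in> B. \<not> E u b}" and ?N = "{b \<in> B. E u b}"
    define z where "z = int (card ?Z)"
    have "B = ?N \<union> ?Z" by auto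
    then have "card B = card (?N \<union> ?Z)" by simp
    also have "\<dots> = card ?N + card ?Z" using fin by (intro card_Un_disjoint) auto
    finally have cB: "card B = card ?N + card ?Z" .
    obtain t :: nat where t: "int (card (S \<inter> ?Z)) \<le> int t * (q - g)" "int (card (S \<inter> ?Z)) \<le> z - int t * g"
      using S_bound[of ?Z] NB_class u unfolding z_def by blast
    have "\<exists>p::nat. int (card (U \<inter> up u)) \<le> int p * (z - g) \<and> int (card (U \<inter> up u)) \<le> int (card (up u)) - int p * g"
    proof (rule U_bound[rule_format])
      show "up u \<subseteq> A" by (auto simp: up_def)
      show "NA K \<inter> up u = {} \<or> NA K \<subseteq> up u \<or> (up u \<subseteq> NA K \<and> (\<forall>x\<in>up u. \<forall>y\<in>A - up u. wt y < wt x))"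
        if K: "K \<in> IL" for K
      proof -
        have cmp: "NA K \<subseteq> up u \<or> up u \<subseteq> NA K"
          using L_A_comparable[OF u, of K] K unfolding IL_def NA_def up_def by blast
        \<comment> \<open>Neighborhoods in \<open>B\<close> form a chain, so a vertex outside
          \<open>up u\<close> sees strictly less of \<open>B\<close> than one inside. This is the
          weight condition for the case \<open>up u \<subseteq> NA K\<close>.\<close>
        have "wt y < wt x" if x: "x \<in> up u" and y: "y \<in> A - up u" for x y
        proof -
          have "{b \<in> B. E y b} \<subset> {b \<in> B. E x b}"
          proof -
            obtain b where b: "b \<in> B" "E u b" "\<not> E y b" using y by (auto simp: up_def)
            have "E x b" using x b by (auto simp: up_def)
            moreover have "E x b'" if b': "b' \<in> B" "E y b'" for b'
              using A_nested[of x y b b'] x y b b' \<open>E x b\<close> by (auto simp: up_def)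
            ultimately show ?thesis using b by auto
          qed
          then show ?thesis unfolding wt_def using fin by (simp add: psubset_card_mono)
        qed
        then show ?thesis using cmp by blast
      qed
      show "int (card (NA K \<inter> up u)) - (r - int (card K)) \<le> z - g" if K: "K \<in> IL" for K
      proof -
        \<comment> \<open>Since \<open>card B = card ?N + z\<close>, this clique bound turns into
          the excess bound \<open>z - g\<close>.\<close>
        have "card K + card (NA K \<inter> up u) + card ?N \<le> w"
        proof (rule w3)
          have K': "K \<subseteq> L" "clique E K" using K by (auto simp: IL_def)
          have sub: "NA K \<inter> up u \<subseteq> A" "?N \<subseteq> B" by (auto simp: up_def)
          show "clique E K" "clique E (NA K \<inter> up u)" "clique E ?N"
            by (rule K' sub_cl[OF Acl sub(1)] sub_cl[OF Bcl sub(2)])+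
          show "E x y" if "x \<in> K" "y \<in> ?N" for x y
            using that K'(1) rev_complete(2)[of x y] by auto
          show "K \<subseteq> V" "NA K \<inter> up u \<subseteq> V" "?N \<subseteq> V"
            by (rule order_trans[OF K'(1) subsets(4)] order_trans[OF sub(1) subsets(2)]
              order_trans[OF sub(2) subsets(3)])+
          show "K \<inter> (NA K \<inter> up u) = {}" "K \<inter> ?N = {}" "NA K \<inter> up u \<inter> ?N = {}"
            by (rule disjoint_subsets[OF K'(1) sub(1) disjoint'(4)]
              disjoint_subsets[OF K'(1) sub(2) disjoint'(5)] disjoint_subsets[OF sub disjoint(5)])+
          show "E x y" if "x \<in> K" "y \<in> NA K \<inter> up u" for x y using that by (simp add: NA_def)
          show "E x y" if "x \<in> NA K \<inter> up u" "y \<in> ?N" for x y using that by (simp add: up_def)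
        qed
        then show ?thesis
          using cB by (simp add: r_def g_def z_def)
      qed
    qed
    then obtain p :: nat where p: "int (card (U \<inter> up u)) \<le> int p * (z - g)"
      "int (card (U \<inter> up u)) \<le> int (card (up u)) - int p * g" by blast
    have "card (up u) \<le> card A" using fin by (intro card_mono) (auto simp: up_def)
    \<comment> \<open>\<open>card (up u)\<close> is bounded by \<open>w - q\<close> because
      \<open>Q \<union> A\<close> is a clique.\<close>
    then have p2: "int (card (U \<inter> up u)) \<le> int w - q - int p * g" using p(2) QAw by (simp add: q_def)
    have "int (card (U \<inter> up u)) + int (card (S \<inter> ?Z)) \<le> z"
      by (rule matching_bound[OF p(1) p2 t g]) (auto simp: q_def z_def)
    moreover have "card ?Z = card (?Z - S) + card (S \<inter> ?Z)"
      using fin card_Diff_subset_Int[of ?Z S] card_mono[of ?Z "?Z \<inter> S"] by (simp add: Int_commute)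
    ultimately show ?thesis by (simp add: z_def)
  qed

  have "\<exists>f. inj_on f U \<and> (\<forall>u\<in>U. f u \<in> {b \<in> B. \<not> E u b} - S)"
  proof (rule nested_matching)
    show "finite U" using U fin finite_subset by blast
    show "finite {b \<in> B. \<not> E u b}" for u using fin by auto
    show "{b \<in> B. \<not> E u b} - S \<subseteq> {b \<in> B. \<not> E u b}" for u by auto
    show "{b \<in> B. \<not> E u b} \<subseteq> {b \<in> B. \<not> E v b} \<or> {b \<in> B. \<not> E v b} \<subseteq> {b \<in> B. \<not> E u b}"
      if "u \<in> U" "v \<in> U" for u v
    proof (rule ccontr)
      assume "\<not> ?thesis"
      then obtain b b' where "b \<in> B" "b' \<in> B" "E u b'" "\<not> E u b" "E v b" "\<not> E v b'" by auto
      then show False using A_nested[of u v b' b] that U by auto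
    qed
    show "card {v \<in> U. {b \<in> B. \<not> E v b} \<subseteq> {b \<in> B. \<not> E u b}} \<le> card ({b \<in> B. \<not> E u b} - S)"
      if "u \<in> U" for u
    proof -
      have "{v \<in> U. {b \<in> B. \<not> E v b} \<subseteq> {b \<in> B. \<not> E u b}} = U \<inter> up u"
        using U by (auto simp: up_def)
      then show ?thesis using hall[of u] that U by auto
    qed
  qed
  then obtain f where f_inj: "inj_on f U" and f: "\<And>u. u \<in> U \<Longrightarrow> f u \<in> B - S \<and> \<not> E u (f u)" by auto

  obtain cB :: "'a \<Rightarrow> nat" where "bij_betw cB B {0..<card B}"
    using ex_bij_betw_finite_nat[OF fin(3)] by blast
  then have cB_inj: "inj_on cB B" and cB_lt: "\<And>b. b \<in> B \<Longrightarrow> cB b < card B"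
    by (auto simp: bij_betw_def)
  have BC: "card B \<le> C" using Bw C by linarith
  define R where "R = {card B..<C}"
  define T where "T = A - U"
  have finT: "finite T" using fin by (simp add: T_def)
  \<comment> \<open>The empty clique belongs to \<open>IL\<close>, so \<open>U_feas\<close> also
    says that all of \<open>T\<close> fits into the colors of \<open>R\<close>.\<close>
  have "NA {} = A" by (auto simp: NA_def)
  then have "int (card T) \<le> r" using U_feas[rule_format, of "{}"] by (simp add: IL_def clique_def T_def)
  then have "card T \<le> card R" by (simp add: r_def R_def)
  then obtain cT where cT_inj: "inj_on cT T" and cT: "cT ` T \<subseteq> R"
    using inj_on_iff_card_le[of T R] finT by (auto simp: R_def)
  define cA where "cA a = (if a \<in> U then cB (f a) else cT a)" for a
  have cA_U: "cA a = cB (f a)" "cA a < card B" if "a \<in> U" for a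
    using that f[OF that] cB_lt by (auto simp: cA_def)
  have cA_T: "cA a = cT a" "card B \<le> cA a" "cA a < C" if "a \<in> T" for a
    using that cT by (auto simp: cA_def T_def R_def)
  have A_cases: "a \<in> U \<or> a \<in> T" if "a \<in> A" for a using that by (auto simp: T_def)
  have cA_lt: "cA a < C" if "a \<in> A" for a
    using A_cases[OF that] cA_U(2)[of a] cA_T(3)[of a] BC by linarith
  have cA_inj: "inj_on cA A"
  proof (rule inj_onI)
    fix x y assume xy: "x \<in> A" "y \<in> A" "cA x = cA y"
    consider "x \<in> U" "y \<in> U" | "x \<in> U" "y \<in> T" | "x \<in> T" "y \<in> U" | "x \<in> T" "y \<in> T"
      using A_cases xy by blast
    then show "x = y"
    proof cases
      case 1
      then have "f x = f y" using xy(3) cA_U(1) f inj_onD[OF cB_inj] by auto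
      then show ?thesis using 1 inj_onD[OF f_inj] by auto
    next
      case 2
      then show ?thesis using cA_U(2)[of x] cA_T(2)[of y] xy(3) by linarith
    next
      case 3
      then show ?thesis using cA_U(2)[of y] cA_T(2)[of x] xy(3) by linarith
    next
      case 4
      then show ?thesis using xy(3) cA_T(1) inj_onD[OF cT_inj] by auto
    qed
  qed
  \<comment> \<open>\<open>f\<close> avoids \<open>S\<close>, and the colors of \<open>T\<close>
    start at \<open>card B\<close>, so no vertex of \<open>A\<close> uses a color of
    \<open>S\<close>.\<close>
  have S_free: "cB ` S \<subseteq> {..<C} - cA ` A"
  proof
    fix p assume "p \<in> cB ` S"
    then obtain s where s: "s \<in> S" "s \<in> B" "p = cB s" using S by auto
    have "cB s \<noteq> cA a" if "a \<in> A" for a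
    proof (cases "a \<in> U")
      case True
      then show ?thesis using f[OF True] s cA_U(1) inj_onD[OF cB_inj, of s "f a"] by auto
    next
      case False
      then have "a \<in> T" using that by (simp add: T_def)
      then show ?thesis using cA_T(2)[of a] cB_lt[OF s(2)] by linarith
    qed
    then show "p \<in> {..<C} - cA ` A" using s cB_lt[OF s(2)] BC by auto
  qed
  have "card (cB ` S) \<le> card Q"
    using S_q card_image_le[of S cB] finite_subset[OF S fin(3)] by linarith
  moreover have "card Q \<le> card ({..<C} - cA ` A)"
  proof -
    have "cA ` A \<subseteq> {..<C}" using cA_lt by auto
    then have "card ({..<C} - cA ` A) = C - card A"
      using fin(2) by (simp add: card_Diff_subset card_image[OF cA_inj])
    then show ?thesis using QAw C by linarith
  qed
  ultimately have "\<exists>W. cB ` S \<subseteq> W \<and> W \<subseteq> {..<C} - cA ` A \<and> card W = card Q"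
    by (rule exists_subset_between) (simp_all add: S_free)
  then obtain W where W: "cB ` S \<subseteq> W" "W \<subseteq> {..<C} - cA ` A" "card W = card Q"
    by (elim exE conjE)
  have finW: "finite W" using W(2) finite_subset by blast
  obtain cQ where cQ: "bij_betw cQ Q W" using finite_same_card_bij[OF fin(1) finW] W(3) by auto

  \<comment> \<open>The palette of \<open>x\<close> avoids \<open>W\<close> and the colors of its
    neighbors in \<open>A\<close>, so only vertices of \<open>B\<close> with a color outside
    \<open>W\<close> can still conflict. None of these lies in \<open>S\<close>, and
    \<open>S_feas\<close> provides the clique bound.\<close>
  have "\<exists>cM. (\<forall>x\<in>M. cM x \<in> {..<C} - W - cA ` {a \<in> A. E x a}) \<and> (\<forall>x\<in>M. \<forall>x'\<in>M. E x x' \<longrightarrow> cM x \<noteq> cM x') \<and>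
     (\<forall>x\<in>M. \<forall>y\<in>{b \<in> B. cB b \<notin> W}. E x y \<longrightarrow> cM x \<noteq> cB y)"
  proof (rule greedy_extension[OF fin(5) fin(3) _ sym irr M_nested M_disjoint M_nbr])
    fix x K assume K: "x \<in> K" "K \<subseteq> M" "clique E K"
    then have KI: "K \<in> IM" by (auto simp: IM_def)
    have "{y \<in> {b \<in> B. cB b \<notin> W}. \<forall>k\<in>K. E k y} \<subseteq> NB K - S" using W(1) by (auto simp: NB_def)
    then have 1: "card {y \<in> {b \<in> B. cB b \<notin> W}. \<forall>k\<in>K. E k y} \<le> card (NB K - S)"
      using fin by (intro card_mono) (auto simp: NB_def)
    have "card (cA ` {a \<in> A. E x a}) \<le> card (NA K)"
      using NA_eq[OF K(2,3,1)] fin by (simp add: card_image_le)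
    moreover have "C - card W \<le> card ({..<C} - W)"
      using diff_card_le_card_Diff[OF finW, of "{..<C}"] by simp
    moreover have "card ({..<C} - W) - card (cA ` {a \<in> A. E x a}) \<le> card ({..<C} - W - cA ` {a \<in> A. E x a})"
      using fin by (intro diff_card_le_card_Diff) auto
    ultimately have "int C - q - int (card (NA K)) \<le> int (card ({..<C} - W - cA ` {a \<in> A. E x a}))"
      using W(3) by (simp add: q_def)
    then show "card K + card {y \<in> {b \<in> B. cB b \<notin> W}. \<forall>k\<in>K. E k y} \<le> card ({..<C} - W - cA ` {a \<in> A. E x a})"
      using S_feas[rule_format, OF KI] 1 by (simp add: hM_def)
  qed auto
  then obtain cM where cM: "\<And>x. x \<in> M \<Longrightarrow> cM x \<in> {..<C} - W - cA ` {a \<in> A. E x a}"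
    "\<And>x x'. \<lbrakk>x \<in> M; x' \<in> M; E x x'\<rbrakk> \<Longrightarrow> cM x \<noteq> cM x'"
    "\<And>x y. \<lbrakk>x \<in> M; y \<in> B; cB y \<notin> W; E x y\<rbrakk> \<Longrightarrow> cM x \<noteq> cB y" by blast

  \<comment> \<open>\<open>L\<close> is complete to \<open>B\<close> and hence confined to
    \<open>R\<close>; the vertices of \<open>U\<close> carry colors of \<open>B\<close>, so within
    \<open>A\<close> only \<open>T\<close> can conflict.\<close>
  have "\<exists>cL. (\<forall>x\<in>L. cL x \<in> R) \<and> (\<forall>x\<in>L. \<forall>x'\<in>L. E x x' \<longrightarrow> cL x \<noteq> cL x') \<and>
     (\<forall>x\<in>L. \<forall>y\<in>T. E x y \<longrightarrow> cL x \<noteq> cT y)"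
  proof (rule greedy_extension[OF fin(4) fin(2) _ sym irr L_nested L_disjoint L_nbr])
    fix x K assume K: "x \<in> K" "K \<subseteq> L" "clique E K"
    have "{y \<in> T. \<forall>k\<in>K. E k y} = NA K - U" by (auto simp: T_def NA_def)
    then show "card K + card {y \<in> T. \<forall>k\<in>K. E k y} \<le> card R"
      using U_feas[rule_format, of K] K by (simp add: IL_def r_def R_def)
  qed (auto simp: T_def)
  then obtain cL where cL: "\<And>x. x \<in> L \<Longrightarrow> cL x \<in> R"
    "\<And>x x'. \<lbrakk>x \<in> L; x' \<in> L; E x x'\<rbrakk> \<Longrightarrow> cL x \<noteq> cL x'"
    "\<And>x y. \<lbrakk>x \<in> L; y \<in> T; E x y\<rbrakk> \<Longrightarrow> cL x \<noteq> cT y" by blast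

  define c where "c v = (if v \<in> Q then cQ v else if v \<in> A then cA v else if v \<in> B then cB v
    else if v \<in> L then cL v else cM v)" for v
  have c_Q: "c v = cQ v" "c v \<in> W" if "v \<in> Q" for v
    using that cQ by (auto simp: c_def bij_betw_def)
  have c_A: "c v = cA v" if "v \<in> A" for v using that disjoint by (auto simp: c_def)
  have c_B: "c v = cB v" if "v \<in> B" for v using that disjoint by (auto simp: c_def)
  have c_L: "c v = cL v" if "v \<in> L" for v using that disjoint by (auto simp: c_def)
  have c_M: "c v = cM v" if "v \<in> M" for v using that disjoint by (auto simp: c_def)
  define ok where "ok X Y \<longleftrightarrow> (\<forall>u\<in>X. \<forall>v\<in>Y. E u v \<longrightarrow> c u \<noteq> c v)" for X Y
  have ok_sym: "ok Y X" if "ok X Y" for X Y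
    unfolding ok_def
  proof (intro ballI impI)
    fix u v assume "u \<in> Y" "v \<in> X" "E u v"
    then show "c u \<noteq> c v" using that sym[of u v] unfolding ok_def by metis
  qed
  have ok_inj: "ok X X" if "inj_on h X" "\<And>v. v \<in> X \<Longrightarrow> c v = h v" for X and h :: "'a \<Rightarrow> nat"
    unfolding ok_def using inj_onD[OF that(1)] that(2) irr by metis
  have QQ: "ok Q Q" using cQ c_Q by (intro ok_inj[of cQ]) (auto simp: bij_betw_def)
  have AA: "ok A A" using cA_inj c_A by (rule ok_inj)
  have BB: "ok B B" using cB_inj c_B by (rule ok_inj)
  have LL: "ok L L" unfolding ok_def using c_L cL(2) by simp
  have MM: "ok M M" unfolding ok_def using c_M cM(2) by simp
  have QA': "ok Q A" unfolding ok_def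
  proof (intro ballI impI)
    fix u v assume "u \<in> Q" "v \<in> A"
    then have "c u \<in> W" "c v \<in> cA ` A" using c_Q c_A by auto
    then show "c u \<noteq> c v" using W(2) by auto
  qed
  have QB': "ok Q B" "ok Q L" "ok L M" unfolding ok_def using QB QL LM by blast+
  have QM': "ok Q M" unfolding ok_def
  proof (intro ballI impI)
    fix u v assume "u \<in> Q" "v \<in> M"
    then have "c u \<in> W" "c v \<notin> W" using c_Q c_M cM(1)[of v] by auto
    then show "c u \<noteq> c v" by auto
  qed
  have AB: "ok A B" unfolding ok_def
  proof (intro ballI impI)
    fix u v assume u: "u \<in> A" and v: "v \<in> B" and e: "E u v"
    show "c u \<noteq> c v"
    proof (cases "u \<in> U")
      case True
      then have "f u \<in> B" "f u \<noteq> v" using f[OF True] e by auto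
      then show ?thesis using inj_onD[OF cB_inj, of "f u" v] cA_U(1)[OF True] c_A[OF u] c_B[OF v] v by auto
    next
      case False
      then have "u \<in> T" using u by (simp add: T_def)
      then show ?thesis using cA_T(2)[of u] cB_lt[OF v] c_A[OF u] c_B[OF v] by linarith
    qed
  qed
  have LA: "ok L A" unfolding ok_def
  proof (intro ballI impI)
    fix u v assume u: "u \<in> L" and v: "v \<in> A" and e: "E u v"
    show "c u \<noteq> c v"
    proof (cases "v \<in> U")
      case True
      have "card B \<le> c u" using cL(1)[OF u] c_L[OF u] by (simp add: R_def)
      then show ?thesis using cA_U(2)[OF True] c_A[OF v] by linarith
    next
      case False
      then have "v \<in> T" using v by (simp add: T_def)
      then show ?thesis using cL(3)[OF u _ e] cA_T(1) c_L[OF u] c_A[OF v] by simp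
    qed
  qed
  have MA: "ok M A" unfolding ok_def using cM(1) c_M c_A by fastforce
  have LB: "ok L B" unfolding ok_def
  proof (intro ballI impI)
    fix u v assume "u \<in> L" "v \<in> B"
    then show "c u \<noteq> c v" using cL(1)[of u] cB_lt[of v] c_L[of u] c_B[of v] by (auto simp: R_def)
  qed
  have MB: "ok M B" unfolding ok_def
  proof (intro ballI impI)
    fix u v assume uv: "u \<in> M" "v \<in> B" "E u v"
    show "c u \<noteq> c v"
    proof (cases "cB v \<in> W")
      case True
      then show ?thesis using cM(1)[OF uv(1)] c_M[OF uv(1)] c_B[OF uv(2)] by auto
    next
      case False
      then show ?thesis using cM(3)[OF uv(1,2) _ uv(3)] c_M[OF uv(1)] c_B[OF uv(2)] by simp
    qed
  qed
  have ok_Un: "ok (X \<union> X') Y" if "ok X Y" "ok X' Y" for X X' Y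
    using that unfolding ok_def by blast
  have ok_Un': "ok Y (X \<union> X')" if "ok Y X" "ok Y X'" for X X' Y
    using that unfolding ok_def by blast
  \<comment> \<open>Together these cover all fifteen unordered pairs of classes, each class paired
    with itself included.\<close>
  note oks = QQ AA BB LL MM QA' QB' QM' AB LA MA LB MB
  have "ok V V"
    unfolding V[symmetric] by (intro ok_Un ok_Un' oks oks[THEN ok_sym])
  moreover have "c v < C" if "v \<in> V" for v
  proof -
    have "v \<in> Q \<or> v \<in> A \<or> v \<in> B \<or> v \<in> L \<or> v \<in> M" using that V by auto
    then show ?thesis
    proof (elim disjE)
      assume "v \<in> Q" then show ?thesis using c_Q(2) W(2) by auto
    next
      assume "v \<in> A" then show ?thesis using c_A cA_lt by simp
    next
      assume "v \<in> B" then show ?thesis using c_B cB_lt[of v] BC by simp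
    next
      assume "v \<in> L" then show ?thesis using c_L cL(1)[of v] by (simp add: R_def)
    next
      assume "v \<in> M" then show ?thesis using c_M cM(1)[of v] by simp
    qed
  qed
  ultimately show ?thesis unfolding ok_def by blast
qed

end

section \<open>From boilers to the chromatic bound\<close>

lemma chromatic_number_le:
  assumes "\<forall>v\<in>V. (c :: 'a \<Rightarrow> nat) v < k" "\<forall>u\<in>V. \<forall>v\<in>V. E u v \<longrightarrow> c u \<noteq> c v"
  shows "chromatic_number V E \<le> k"
  unfolding chromatic_number_def using assms by (intro Least_le exI[of _ c] conjI)

lemma card_le_clique_number:
  assumes "finite V" "K \<subseteq> V" "clique E K"
  shows "card K \<le> clique_number V E"
proof -
  have "finite {card K | K. K \<subseteq> V \<and> clique E K}"
    by (rule finite_subset[of _ "card ` Pow V"]) (use assms(1) in auto)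
  moreover have "card K \<in> {card K | K. K \<subseteq> V \<and> clique E K}" using assms(2,3) by blast
  ultimately show ?thesis unfolding clique_number_def by (rule Max_ge)
qed

lemma boiler_imp_boiler_core:
  assumes "boiler V E"
  shows "\<exists>Q A B L M. boiler_core V E Q A B L M"
proof -
  have gr: "graph V E" and C4: "C_free 4 V E" using assms by (auto simp: boiler_def)
  have sym: "E v u" if "E u v" for u v using gr that by (simp add: graph_def)
  obtain Q A B L M and k :: nat and Ms Bs where
    part: "Q \<union> A \<union> B \<union> L \<union> M = V"
      "Q \<inter> A = {}" "Q \<inter> B = {}" "Q \<inter> L = {}" "Q \<inter> M = {}" "A \<inter> B = {}" "A \<inter> L = {}" "A \<inter> M = {}"
      "B \<inter> L = {}" "B \<inter> M = {}" "L \<inter> M = {}" "Q \<noteq> {}"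
    and cl: "clique E Q" "clique E A" "clique E B"
    and compl: "complete_to E Q A" "complete_to E Q M" "complete_to E B L"
      "anticomplete_to E Q B" "anticomplete_to E Q L" "anticomplete_to E L M"
    and L_nbr: "\<forall>l\<in>L. \<exists>a\<in>A. E l a"
    and M: "M = (\<Union>i\<in>{1..k}. Ms i)" and B: "B = (\<Union>i\<in>{1..k}. Bs i)"
    and M_nbr: "\<forall>i\<in>{1..k}. \<forall>m\<in>Ms i. (\<exists>b\<in>Bs i. E m b) \<and> (\<forall>b\<in>B - Bs i. \<not> E m b)"
    and first: "complete_to E A (Ms 1 \<union> Bs 1 \<union> Ms 2 \<union> Bs 2)"
    and rest: "\<forall>i\<in>{3..k}. \<forall>a\<in>A. complete_to E {a} (Ms i \<union> Bs i) \<or> anticomplete_to E {a} (Ms i \<union> Bs i)"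
    and miss: "\<forall>a\<in>A. \<not> complete_to E {a} B"
    using assms unfolding boiler_def by (elim exE conjE) (rule that)
  have twins: "E a m \<longleftrightarrow> E a b" if a: "a \<in> A" and bm: "b \<in> B" "m \<in> M" "E m b" for a b m
  proof -
    obtain i where i: "i \<in> {1..k}" "m \<in> Ms i" using bm(2) M by auto
    \<comment> \<open>\<open>M_nbr\<close> rules out neighbors of \<open>m\<close> in other pieces,
      so \<open>b\<close> and \<open>m\<close> share the index \<open>i\<close>. Pieces 1 and 2 are
      complete to \<open>A\<close>, and \<open>a\<close> is uniform on every other one.\<close>
    have b: "b \<in> Bs i" using M_nbr i bm(1,3) by blast
    have "i = 1 \<or> i = 2 \<or> i \<in> {3..k}" using i(1) by auto
    then show ?thesis
    proof (elim disjE)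
      assume "i \<in> {3..k}"
      then have "complete_to E {a} (Ms i \<union> Bs i) \<or> anticomplete_to E {a} (Ms i \<union> Bs i)"
        using rest a by blast
      then show ?thesis using i(2) b by (auto simp: complete_to_def anticomplete_to_def)
    qed (use first i(2) b a in \<open>auto simp: complete_to_def\<close>)
  qed
  have "boiler_core V E Q A B L M"
  proof
    show "finite V" "\<And>v. \<not> E v v" using gr by (auto simp: graph_def)
    show "E a c \<or> E b d"
      if "{a, b, c, d} \<subseteq> V" "E a b" "E b c" "E c d" "E d a" "a \<noteq> c" "b \<noteq> d" for a b c d
      using C4_free_square[OF C4 gr that] .
    show "\<exists>b\<in>B. E m b" if mM: "m \<in> M" for m
    proof -
      obtain i where i: "i \<in> {1..k}" "m \<in> Ms i" using mM M by auto
      then obtain b where "b \<in> Bs i" "E m b" using M_nbr by blast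
      then show ?thesis using B i(1) by auto
    qed
    show "\<exists>b\<in>B. \<not> E a b" if "a \<in> A" for a using that miss by (auto simp: complete_to_def)
    show "E v u" if "E u v" for u v using sym[OF that] .
    show "E a m \<longleftrightarrow> E a b" if "a \<in> A" "b \<in> B" "m \<in> M" "E m b" for a b m using twins[OF that] .
    show "\<exists>a\<in>A. E l a" if "l \<in> L" for l using L_nbr that by blast
  qed (use compl in \<open>simp_all add: part cl complete_to_def anticomplete_to_def\<close>)
  then show ?thesis by blast
qed

theorem theorem5p16:
  fixes V :: "'a set" and E :: "'a \<Rightarrow> 'a \<Rightarrow> bool"
  assumes "boiler V E"
  shows "int (chromatic_number V E) \<le> \<lceil>(5 / 4 :: real) * real (clique_number V E)\<rceil>"
proof -
  obtain Q A B L M where core: "boiler_core V E Q A B L M"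
    using boiler_imp_boiler_core[OF assms] by blast
  \<comment> \<open>The ceiling is non-negative, so \<open>nat\<close> loses nothing, and rounding
    up keeps \<open>C\<close> at least 5/4 of the clique number.\<close>
  define C where "C = nat \<lceil>(5 / 4 :: real) * real (clique_number V E)\<rceil>"
  have int_C: "int C = \<lceil>(5 / 4 :: real) * real (clique_number V E)\<rceil>" by (simp add: C_def)
  then have "(5 / 4 :: real) * real (clique_number V E) \<le> real C"
    using le_of_int_ceiling[of "(5 / 4 :: real) * real (clique_number V E)"] by linarith
  then have "5 * clique_number V E \<le> 4 * C" by linarith
  then obtain c :: "'a \<Rightarrow> nat" where "\<forall>v\<in>V. c v < C" "\<forall>u\<in>V. \<forall>v\<in>V. E u v \<longrightarrow> c u \<noteq> c v"
    using boiler_core.coloring[OF core card_le_clique_number[OF boiler_core.finV[OF core]]] by blast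
  then have "chromatic_number V E \<le> C" by (rule chromatic_number_le)
  then show ?thesis using int_C by linarith
qed

end
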